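(* Let $k,l,a,b$ be positive integers with $\max\{a,b\}\ge 2$. Then every positive rational number $r$ can be written in the form $$r=\frac{\varphi(km^{a})}{\varphi(ln^{b})}\quad\text{with } m,n\in\mathbb{N}$$ if and only if $\gcd(a,b)=1$ or $(a,b,k,l)=(2,2,1,1)$. Moreover, if $\gcd(a,b)>1$, then every positive rational number $r$ has at most one proper representation of this form; that is, if $(m,n)$ and $(m',n')$ are pairs of positive integers such that $r=\varphi(km^a)/\varphi(ln^b)$ and $r=\varphi(km'^a)/\varphi(ln'^b)$ are both proper representations of $r$, then $(m,n)=(m',n')$.
   Context: $\varphi$ denotes Euler's totient function and $\mathbb{N}$ the set of positive integers. Fix positive integers $k,l,a,b$ with $\min\{a,b\}\ge 2$ (which is automatic when $\gcd(a,b)>1$). For a positive rational number $r$ and positive integers $m,n$ with $r=\varphi(km^a)/\varphi(ln^b)$, this representation of $r$ is called proper if there do NOT exist positive integers $d_1>1$, $d_2$, $m_1$, $n_1$ such that $m=m_1d_1$, $n=n_1d_2$, $d_1^a=d_2^b$, and for each prime $p$ dividing $d_1d_2$, either $p\mid\gcd(km_1,\,ln_1)$ or $\gcd(p,\,klm_1n_1)=1$. *)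

theory Defs
  imports Complex_Main "HOL-Number_Theory.Totient"
begin

definition totient_repr :: "nat \<Rightarrow> nat \<Rightarrow> nat \<Rightarrow> nat \<Rightarrow> rat \<Rightarrow> nat \<Rightarrow> nat \<Rightarrow> bool" where
  "totient_repr k l a b r m n \<longleftrightarrow>
     m > 0 \<and> n > 0 \<and> r = of_nat (totient (k * m ^ a)) / of_nat (totient (l * n ^ b))"

definition proper_totient_repr :: "nat \<Rightarrow> nat \<Rightarrow> nat \<Rightarrow> nat \<Rightarrow> rat \<Rightarrow> nat \<Rightarrow> nat \<Rightarrow> bool" where
  "proper_totient_repr k l a b r m n \<longleftrightarrow>
     totient_repr k l a b r m n \<and>
     \<not> (\<exists>d1 d2 m1 n1 :: nat. d1 > 1 \<and> d2 > 0 \<and> m1 > 0 \<and> n1 > 0 \<and>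
          m = m1 * d1 \<and> n = n1 * d2 \<and> d1 ^ a = d2 ^ b \<and>
          (\<forall>p. prime p \<and> p dvd d1 * d2 \<longrightarrow>
             p dvd gcd (k * m1) (l * n1) \<or> gcd p (k * l * m1 * n1) = 1))"

end

theory Submission
  imports Defs
begin

text \<open>
  Write \<open>f e = e - 1\<close> (truncated) and \<open>v\<^sub>p\<close> for the \<open>p\<close>-adic valuation, and let
  \<open>x = v\<^sub>p(m)\<close>, \<open>y = v\<^sub>p(n)\<close>. Then \<open>v\<^sub>p(\<phi>(N))\<close> is
  \<open>f(v\<^sub>p(N))\<close> plus a term that depends only on the prime divisors of \<open>N\<close> above \<open>p\<close>. So a
  representation of \<open>r\<close> can be analysed prime by prime, from the largest prime downwards, and at
  each prime only a value of \<open>f(v\<^sub>p(k) + a x) - f(v\<^sub>p(l) + b y)\<close> is prescribed.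
  If \<open>gcd a b > 1\<close>, congruences modulo \<open>gcd a b\<close> decide which of \<open>km\<^sup>a\<close>, \<open>ln\<^sup>b\<close> are divisible by
  \<open>p\<close>, which yields both the failure of surjectivity and the uniqueness of \<open>(x, y)\<close> up to the
  cancellation excluded by properness.
  If \<open>gcd a b = 1\<close>, one can choose \<open>km\<^sup>a\<close> and \<open>ln\<^sup>b\<close> with quotient \<open>r\<close> and with the same prime
  divisors, and then the quotient of the totients is \<open>r\<close> as well.
\<close>

section \<open>Valuations of totients\<close>

text \<open>The share of the factors \<open>q - 1\<close> in the valuation of the totient. Primes
  \<open>q \<le> p\<close> may be left out, since 0 < q - 1 < p or q = 2 = p gives valuation zero.
  Hence the sum sees which primes above \<open>p\<close> divide \<open>N\<close>, but not their
  exponents.\<close>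

definition totient_tail :: "nat \<Rightarrow> nat \<Rightarrow> nat" where
  "totient_tail p N = (\<Sum>q | q \<in> prime_factors N \<and> q > p. multiplicity p (q - 1))"

lemma multiplicity_totient:
  assumes p: "prime p" and N: "N > 0"
  shows "multiplicity p (totient N) = (multiplicity p N - 1) + totient_tail p N"
proof -
  let ?P = "prime_factors N"
  have pr: "prime q" if "q \<in> ?P" for q using that by auto
  have q1: "q - 1 > 0" if "q \<in> ?P" for q using pr[OF that] prime_gt_1_nat by auto
  have "multiplicity p (totient N) =
        (\<Sum>q\<in>?P. multiplicity p (q ^ (multiplicity q N - 1) * (q - 1)))"
    unfolding totient_formula1[OF N] using p q1 pr
    by (subst prime_elem_multiplicity_prod_distrib) (fastforce dest: prime_gt_0_nat)+
  also have "\<dots> = (\<Sum>q\<in>?P. (if q = p then multiplicity p N - 1 else 0) +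
                            (if q > p then multiplicity p (q - 1) else 0))"
  proof (rule sum.cong[OF refl])
    fix q assume q: "q \<in> ?P"
    have "multiplicity p (q ^ (multiplicity q N - 1) * (q - 1)) =
          multiplicity p (q ^ (multiplicity q N - 1)) + multiplicity p (q - 1)"
      using p q1[OF q] pr[OF q] by (subst prime_elem_multiplicity_mult_distrib) auto
    also have "multiplicity p (q ^ (multiplicity q N - 1)) = (if q = p then multiplicity p N - 1 else 0)"
      using p pr[OF q] by (auto simp: multiplicity_distinct_prime_power)
    also have "multiplicity p (q - 1) = (if q > p then multiplicity p (q - 1) else 0)"
      using q1[OF q] by (auto intro!: not_dvd_imp_multiplicity_0 dest!: dvd_imp_le)
    finally show "multiplicity p (q ^ (multiplicity q N - 1) * (q - 1)) =
      (if q = p then multiplicity p N - 1 else 0) + (if q > p then multiplicity p (q - 1) else 0)" .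
  qed
  also have "\<dots> = (\<Sum>q\<in>?P. if q = p then multiplicity p N - 1 else 0) +
                  (\<Sum>q\<in>?P. if q > p then multiplicity p (q - 1) else 0)"
    by (rule sum.distrib)
  \<comment> \<open>If \<open>p\<close> does not divide \<open>N\<close>, the sum is empty of
    nonzero terms; the truncated value 0 - 1 = 0 agrees with this.\<close>
  also have "(\<Sum>q\<in>?P. if q = p then multiplicity p N - 1 else 0) = multiplicity p N - 1"
    using p N by (auto simp: prime_factors_dvd not_dvd_imp_multiplicity_0)
  also have "(\<Sum>q\<in>?P. if q > p then multiplicity p (q - 1) else 0) = totient_tail p N"
    unfolding totient_tail_def by (subst sum.inter_filter[symmetric]) auto
  finally show ?thesis .
qed

lemma totient_tail_cong:
  assumes "M > 0" "N > 0" "\<And>q. prime q \<Longrightarrow> q > p \<Longrightarrow> q dvd M \<longleftrightarrow> q dvd N"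
  shows "totient_tail p M = totient_tail p N"
  unfolding totient_tail_def
  by (rule sum.cong) (use assms in \<open>auto simp: prime_factors_dvd\<close>)

lemma prime_dvd_prime_power_imp_eq:
  fixes p q :: nat
  assumes "prime q" "prime p" "q dvd p ^ e"
  shows "q = p"
  using assms prime_dvd_power primes_dvd_imp_eq by blast

lemma multiplicity_mult_power:
  fixes p k m :: nat
  assumes "prime p" "k > 0" "m > 0"
  shows "multiplicity p (k * m ^ a) = multiplicity p k + a * multiplicity p m"
  using assms by (simp add: prime_elem_multiplicity_mult_distrib prime_elem_multiplicity_power_distrib)

section \<open>Clearing denominators: rational numbers and natural equations\<close>

lemma totient_repr_cross:
  assumes "totient_repr k l a b (of_nat u / of_nat w) m n" "l > 0" "w > 0"
  shows "totient (k * m ^ a) * w = totient (l * n ^ b) * u"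
proof -
  have "(of_nat u / of_nat w :: rat) = of_nat (totient (k * m ^ a)) / of_nat (totient (l * n ^ b))"
    and "n > 0"
    using assms(1) by (auto simp: totient_repr_def)
  hence "(of_nat u :: rat) * of_nat (totient (l * n ^ b)) = of_nat (totient (k * m ^ a)) * of_nat w"
    using assms by (simp add: frac_eq_eq)
  hence "(of_nat (u * totient (l * n ^ b)) :: rat) = of_nat (totient (k * m ^ a) * w)"
    by simp
  thus ?thesis unfolding of_nat_eq_iff by (simp add: mult.commute)
qed

lemma totient_reprI:
  assumes "totient (k * m ^ a) * w = totient (l * n ^ b) * u" "l > 0" "w > 0" "m > 0" "n > 0"
  shows "totient_repr k l a b (of_nat u / of_nat w) m n"
proof -
  have "(of_nat (totient (k * m ^ a) * w) :: rat) = of_nat (totient (l * n ^ b) * u)"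
    unfolding assms(1) ..
  thus ?thesis using assms
    by (simp add: totient_repr_def frac_eq_eq mult_ac)
qed

lemma pos_rat_as_fraction:
  assumes "(r :: rat) > 0"
  obtains u w :: nat where "u > 0" "w > 0" "r = of_nat u / of_nat w"
proof -
  obtain x y where "r = Fract x y" "y > 0" "x > 0"
    using assms by (cases r) (auto simp: zero_less_Fract_iff)
  thus ?thesis using that[of "nat x" "nat y"] by (simp add: Fract_of_int_quotient)
qed

section \<open>Existence of representations\<close>

text \<open>The ratio of \<open>totient N\<close> to \<open>N\<close> is the product of 1 - 1/q over
  the primes q dividing \<open>N\<close>, so it depends on the set of prime divisors only.\<close>

lemma totient_cross_same_primes:
  fixes M N :: nat
  assumes "prime_factors M = prime_factors N"
  shows "totient M * N = totient N * M"
proof -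
  have "real (totient M * N) = real (totient N * M)"
    using totient_formula2[of M] totient_formula2[of N] assms by simp
  thus ?thesis unfolding of_nat_eq_iff .
qed

lemma bezout_pos_nat:
  fixes a b :: nat
  assumes "a > 0" "b > 0" "gcd a b = 1"
  obtains i j where "i > 0" "j > 0" "a * i = b * j + 1"
proof -
  obtain x y where "a * x = b * y + 1"
    using bezout_nat[of a b] assms by auto
  \<comment> \<open>Shifting the solution by (b, a) keeps the equation and makes both coefficients
    positive. They serve below as exponents that must not make a base disappear.\<close>
  hence "a * (x + b) = b * (y + a) + 1" by (simp add: algebra_simps)
  thus ?thesis using that[of "x + b" "y + a"] assms by simp
qed

lemma ex_totient_repr_coprime:
  assumes "k > 0" "l > 0" "a > 0" "b > 0" "gcd a b = 1" "(r :: rat) > 0"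
  shows "\<exists>m n. totient_repr k l a b r m n"
proof -
  obtain u w :: nat where uw: "u > 0" "w > 0" "r = of_nat u / of_nat w"
    using pos_rat_as_fraction[OF assms(6)] .
  obtain i j where ij: "i > 0" "j > 0" "a * i = b * j + 1"
    using bezout_pos_nat[OF assms(3-5)] .
  obtain i' j' where ij': "i' > 0" "j' > 0" "b * i' = a * j' + 1"
    using bezout_pos_nat[OF assms(4,3)] assms(5) by (metis gcd.commute)
  \<comment> \<open>The goal \<open>k * m ^ a * w = l * n ^ b * u\<close> reads
    \<open>s * m ^ a = t * n ^ b\<close>. Comparing exponents of \<open>s\<close> and
    \<open>t\<close> leaves exactly the two Bezout equations. Since \<open>k\<close> divides
    \<open>s\<close>, \<open>l\<close> divides \<open>t\<close> and all four exponents are positive,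
    both sides \<open>?M\<close> and \<open>?N\<close> have the prime divisors of
    \<open>s * t\<close>.\<close>
  define s t m n where "s = k * w" and "t = l * u" and "m = s ^ j' * t ^ i" and "n = s ^ i' * t ^ j"
  have pos: "s > 0" "t > 0" "m > 0" "n > 0"
    using assms uw by (simp_all add: s_def t_def m_def n_def)
  have pf_pow: "prime_factors (x ^ e) = prime_factors x" if "e > 0" for x e :: nat
    using that by (rule prime_factors_power)
  have pf_mult: "prime_factors (x * y) = prime_factors x \<union> prime_factors y"
    if "x > 0" "y > 0" for x y :: nat
    using that by (simp add: prime_factorization_mult)
  let ?M = "k * m ^ a" and ?N = "l * n ^ b"
  have eq: "?M * w = ?N * u"
  proof -
    have "m ^ a * s = s ^ (a * j' + 1) * t ^ (a * i)"
      by (simp add: m_def power_mult_distrib power_mult [symmetric] mult_ac)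
    also have "\<dots> = s ^ (b * i') * t ^ (b * j + 1)"
      using ij ij' by simp
    also have "\<dots> = n ^ b * t"
      by (simp add: n_def power_mult_distrib power_mult [symmetric] mult_ac)
    finally show ?thesis by (simp add: s_def t_def mult_ac)
  qed
  have "prime_factors ?M = prime_factors s \<union> prime_factors t"
    using assms uw pos ij ij' by (auto simp: pf_mult pf_pow m_def) (auto simp: pf_mult s_def)
  moreover have "prime_factors ?N = prime_factors s \<union> prime_factors t"
    using assms uw pos ij ij' by (auto simp: pf_mult pf_pow n_def) (auto simp: pf_mult t_def)
  ultimately have tot: "totient ?M * ?N = totient ?N * ?M"
    by (intro totient_cross_same_primes) simp
  have "(totient ?M * w) * ?N = totient ?N * (?M * w)"
    using tot by (simp add: mult_ac)
  also have "\<dots> = (totient ?N * u) * ?N"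
    unfolding eq by (simp only: mult_ac)
  finally have "totient ?M * w = totient ?N * u"
    using pos assms by simp
  thus ?thesis
    unfolding uw(3) using totient_reprI[of k m a w l n b u] assms(2) uw(2) pos by blast
qed

section \<open>Quotients of totients of squares\<close>

lemma totient_prime_power_mult_square:
  fixes p m :: nat
  assumes "prime p" "\<not> p dvd m" "e > 0"
  shows "totient ((p ^ e * m)\<^sup>2) = p ^ (2 * e - 1) * (p - 1) * totient (m\<^sup>2)"
proof -
  have cop: "coprime (p ^ (2 * e)) (m\<^sup>2)"
    using assms by (simp add: prime_imp_coprime)
  have "(p ^ e * m)\<^sup>2 = p ^ (2 * e) * m\<^sup>2"
    by (simp add: power_mult_distrib power_mult [symmetric] mult.commute)
  thus ?thesis
    using assms by (simp add: totient_mult_coprime[OF cop] totient_prime_power)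
qed

text \<open>
  Exponents \<open>i\<close>, \<open>j\<close> of \<open>p\<close> of equal parity are realised by making both \<open>m\<close> and \<open>n\<close> divisible
  by \<open>p\<close>; for different parity exactly one of them is divisible by \<open>p\<close>, and the resulting factor
  \<open>p - 1\<close> is moved to the smooth part of the fraction.
\<close>
lemma ex_totient_square_smooth:
  fixes u w :: nat
  assumes "u > 0" "w > 0" "\<And>q. prime q \<Longrightarrow> q dvd u * w \<Longrightarrow> q < P"
  shows "\<exists>m n. m > 0 \<and> n > 0 \<and> (\<forall>q. prime q \<longrightarrow> q dvd m * n \<longrightarrow> q < P) \<and>
           totient (m\<^sup>2) * w = totient (n\<^sup>2) * u"
  using assms
proof (induction P arbitrary: u w)
  \<comment> \<open>No prime lies below 0, so \<open>u\<close> and \<open>w\<close> are both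
    1.\<close>
  case 0
  have "u * w = 1"
    using prime_factor_nat[of "u * w"] "0.prems"(3) by blast
  thus ?case by (intro exI[of _ 1]) auto
next
  case (Suc p)
  show ?case
  proof (cases "prime p")
    case False
    have "q < p" if "prime q" "q dvd u * w" for q
      using Suc.prems(3)[OF that] that False by (metis less_SucE)
    from Suc.IH[OF Suc.prems(1,2) this] show ?thesis
      by (meson less_SucI)
  next
    case p: True
    have p0: "p \<noteq> 0" "\<not> is_unit p" "p > 1" "p - 1 > 0"
      using p prime_gt_1_nat[OF p] by auto
    define i j where "i = multiplicity p u" and "j = multiplicity p w"
    obtain u' where u': "u = p ^ i * u'" "\<not> p dvd u'"
      using multiplicity_decompose'[of u p] Suc.prems(1) p0 unfolding i_def by blast
    obtain w' where w': "w = p ^ j * w'" "\<not> p dvd w'"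
      using multiplicity_decompose'[of w p] Suc.prems(2) p0 unfolding j_def by blast
    have pos: "u' > 0" "w' > 0" using u' w' Suc.prems by (auto intro!: Nat.gr0I)
    have small: "q < p" if "prime q" "q dvd u' * (p - 1) \<or> q dvd w' * (p - 1) \<or> q dvd u' * w'" for q
    proof -
      have "q dvd u' \<or> q dvd w' \<or> q dvd p - 1"
        using that by (auto simp: prime_dvd_mult_iff)
      thus ?thesis
      proof (elim disjE)
        assume "q dvd p - 1"
        hence "q \<le> p - 1" using p0 by (intro dvd_imp_le)
        thus ?thesis using p0 by linarith
      next
        assume h: "q dvd u'"
        hence "q < Suc p" using Suc.prems(3)[OF that(1)] u' by simp
        thus ?thesis using h u' by (metis less_SucE)
      next
        assume h: "q dvd w'"
        hence "q < Suc p" using Suc.prems(3)[OF that(1)] w' by simp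
        thus ?thesis using h w' by (metis less_SucE)
      qed
    qed
    \<comment> \<open>The exponents may be 0, for the cases in which only one of the two numbers
      receives the prime \<open>p\<close>.\<close>
    have lift: "\<forall>q. prime q \<longrightarrow> q dvd (p ^ e * m) * (p ^ f * n) \<longrightarrow> q < Suc p"
      if "\<forall>q. prime q \<longrightarrow> q dvd m * n \<longrightarrow> q < p" for m n e f
      using that prime_dvd_prime_power_imp_eq[OF _ p]
      by (auto simp: prime_dvd_mult_iff less_Suc_eq)
    have ndvd: "\<not> p dvd m \<and> \<not> p dvd n" if "\<forall>q. prime q \<longrightarrow> q dvd m * n \<longrightarrow> q < p" for m n
      using that p by auto
    consider (eq) "even (i + j)" | (gt) "odd (i + j)" "j < i" | (lt) "odd (i + j)" "i < j"
      by (metis even_add linorder_neqE_nat)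
    thus ?thesis
    proof cases
      case eq
      obtain m n where mn: "m > 0" "n > 0" "\<forall>q. prime q \<longrightarrow> q dvd m * n \<longrightarrow> q < p"
        "totient (m\<^sup>2) * w' = totient (n\<^sup>2) * u'"
        using Suc.IH[of u' w'] pos small by blast
      \<comment> \<open>The exponents \<open>i + 1\<close> and \<open>h + 1\<close> balance the
        powers of \<open>p\<close>: (2i + 1) + j = (2h + 1) + i. Being positive, they produce the
        factor \<open>p - 1\<close> on both sides, where it cancels.\<close>
      from eq obtain h where h: "i + j = 2 * h" by (elim evenE)
      have exps: "(2 * (i + 1) - 1) + j = (2 * (h + 1) - 1) + i" using h by simp
      have M: "totient ((p ^ (i + 1) * m)\<^sup>2) = p ^ (2 * (i + 1) - 1) * (p - 1) * totient (m\<^sup>2)"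
        by (rule totient_prime_power_mult_square) (use p ndvd[OF mn(3)] in simp_all)
      have N: "totient ((p ^ (h + 1) * n)\<^sup>2) = p ^ (2 * (h + 1) - 1) * (p - 1) * totient (n\<^sup>2)"
        by (rule totient_prime_power_mult_square) (use p ndvd[OF mn(3)] in simp_all)
      have "totient ((p ^ (i + 1) * m)\<^sup>2) * w =
            p ^ ((2 * (i + 1) - 1) + j) * (p - 1) * (totient (m\<^sup>2) * w')"
        unfolding M w'(1) by (simp only: power_add mult_ac)
      also have "\<dots> = totient ((p ^ (h + 1) * n)\<^sup>2) * u"
        unfolding exps mn(4) N u'(1) by (simp only: power_add mult_ac)
      finally show ?thesis using lift[OF mn(3), of "i + 1" "h + 1"] mn(1,2) p0
        by (intro exI[of _ "p ^ (i + 1) * m"] exI[of _ "p ^ (h + 1) * n"]) simp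
    next
      case gt
      obtain m n where mn: "m > 0" "n > 0" "\<forall>q. prime q \<longrightarrow> q dvd m * n \<longrightarrow> q < p"
        "totient (m\<^sup>2) * (w' * (p - 1)) = totient (n\<^sup>2) * u'"
        using Suc.IH[of u' "w' * (p - 1)"] pos small p0
        by (metis (no_types, opaque_lifting) mult_pos_pos prime_dvd_mult_iff)
      \<comment> \<open>Only \<open>m\<close> receives \<open>p\<close>, with exponent
        \<open>e + 1\<close>, because 2(e + 1) - 1 must equal i - j.\<close>
      obtain e where e: "i = j + 2 * e + 1"
        using gt by (metis add.commute even_add le_add_diff_inverse less_imp_le oddE add.assoc)
      have exps: "(2 * (e + 1) - 1) + j = i" using e by simp
      have M: "totient ((p ^ (e + 1) * m)\<^sup>2) = p ^ (2 * (e + 1) - 1) * (p - 1) * totient (m\<^sup>2)"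
        by (rule totient_prime_power_mult_square) (use p ndvd[OF mn(3)] in simp_all)
      have "totient ((p ^ (e + 1) * m)\<^sup>2) * w =
            p ^ ((2 * (e + 1) - 1) + j) * (totient (m\<^sup>2) * (w' * (p - 1)))"
        unfolding M w'(1) by (simp only: power_add mult_ac)
      also have "\<dots> = totient (n\<^sup>2) * u"
        unfolding exps mn(4) u'(1) by (simp only: mult_ac)
      finally show ?thesis using lift[OF mn(3), of "e + 1" 0] mn(1,2) p0
        by (intro exI[of _ "p ^ (e + 1) * m"] exI[of _ n]) simp
    next
      case lt
      obtain m n where mn: "m > 0" "n > 0" "\<forall>q. prime q \<longrightarrow> q dvd m * n \<longrightarrow> q < p"
        "totient (m\<^sup>2) * w' = totient (n\<^sup>2) * (u' * (p - 1))"
        using Suc.IH[of "u' * (p - 1)" w'] pos small p0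
        by (metis (no_types, opaque_lifting) mult_pos_pos prime_dvd_mult_iff)
      obtain e where e: "j = i + 2 * e + 1"
        using lt by (metis add.commute even_add le_add_diff_inverse less_imp_le oddE add.assoc)
      have exps: "(2 * (e + 1) - 1) + i = j" using e by simp
      have N: "totient ((p ^ (e + 1) * n)\<^sup>2) = p ^ (2 * (e + 1) - 1) * (p - 1) * totient (n\<^sup>2)"
        by (rule totient_prime_power_mult_square) (use p ndvd[OF mn(3)] in simp_all)
      have "totient (m\<^sup>2) * w = p ^ ((2 * (e + 1) - 1) + i) * (totient (m\<^sup>2) * w')"
        unfolding exps w'(1) by (simp only: mult_ac)
      also have "\<dots> = totient ((p ^ (e + 1) * n)\<^sup>2) * u"
        unfolding mn(4) N u'(1) by (simp only: power_add mult_ac)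
      finally show ?thesis using lift[OF mn(3), of 0 "e + 1"] mn(1,2) p0
        by (intro exI[of _ m] exI[of _ "p ^ (e + 1) * n"]) simp
    qed
  qed
qed

lemma ex_totient_repr_squares:
  assumes "(r :: rat) > 0"
  shows "\<exists>m n. totient_repr 1 1 2 2 r m n"
proof -
  obtain u w :: nat where uw: "u > 0" "w > 0" "r = of_nat u / of_nat w"
    using pos_rat_as_fraction[OF assms] .
  have "q < Suc (u * w)" if "prime q" "q dvd u * w" for q
    using dvd_imp_le[OF that(2)] uw by simp
  from ex_totient_square_smooth[OF uw(1,2) this]
  obtain m n where "m > 0" "n > 0" "totient (m\<^sup>2) * w = totient (n\<^sup>2) * u"
    by auto
  thus ?thesis unfolding uw(3) using totient_reprI[of 1 m 2 w 1 n 2 u] uw(2) by auto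
qed

section \<open>Rational numbers without a representation\<close>

text \<open>At the largest prime above \<open>P\<close> where the two divisibilities differ, the
  tails agree and \<open>k\<close>, \<open>l\<close>, \<open>u\<close>, \<open>w\<close> contribute
  nothing. What remains is an equation between truncated predecessors of multiples of
  \<open>a\<close> and \<open>b\<close>, which tells zero from nonzero valuations.\<close>

lemma totient_eq_imp_same_large_primes:
  fixes k l a b m n u w P :: nat
  assumes pos: "k > 0" "l > 0" "m > 0" "n > 0" "u > 0" "w > 0" and ab: "a \<ge> 2" "b \<ge> 2"
  assumes eq: "totient (k * m ^ a) * w = totient (l * n ^ b) * u"
  assumes large: "\<And>q. prime q \<Longrightarrow> q > P \<Longrightarrow> \<not> q dvd k * l * u * w"
  assumes q: "prime q" "q > P"
  shows "q dvd k * m ^ a \<longleftrightarrow> q dvd l * n ^ b"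
proof (rule ccontr)
  let ?M = "k * m ^ a" and ?N = "l * n ^ b"
  assume neg: "\<not> ?thesis"
  define D where "D = {q. prime q \<and> q > P \<and> (q dvd ?M) \<noteq> (q dvd ?N)}"
  have MN: "?M > 0" "?N > 0" using pos by simp_all
  have "D \<subseteq> prime_factors ?M \<union> prime_factors ?N"
    using MN by (auto simp: D_def prime_factors_dvd)
  hence fin: "finite D" by (rule finite_subset) auto
  have ne: "D \<noteq> {}" using neg q by (auto simp: D_def)
  define p where "p = Max D"
  have pD: "p \<in> D" unfolding p_def by (rule Max_in[OF fin ne])
  hence p: "prime p" "p > P" "(p dvd ?M) \<noteq> (p dvd ?N)" by (auto simp: D_def)
  have agree: "q dvd ?M \<longleftrightarrow> q dvd ?N" if "prime q" "q > p" for q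
  proof (rule ccontr)
    assume "\<not> ?thesis"
    hence "q \<in> D" using that p by (auto simp: D_def)
    hence "q \<le> p" unfolding p_def by (rule Max_ge[OF fin])
    thus False using that by simp
  qed
  have tail: "totient_tail p ?M = totient_tail p ?N"
    using MN agree by (intro totient_tail_cong)
  have nd: "\<not> p dvd k" "\<not> p dvd l" "\<not> p dvd u" "\<not> p dvd w"
    using large[OF p(1,2)] by auto
  have "multiplicity p (totient ?M * w) = multiplicity p (totient ?N * u)"
    using eq by simp
  hence "multiplicity p (totient ?M) + multiplicity p w = multiplicity p (totient ?N) + multiplicity p u"
    using pos MN p(1) by (simp add: prime_elem_multiplicity_mult_distrib)
  hence E: "a * multiplicity p m - 1 = b * multiplicity p n - 1"
    using nd tail p(1) MN pos
    by (simp add: multiplicity_totient multiplicity_mult_power not_dvd_imp_multiplicity_0)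
  have "multiplicity p m = 0 \<longleftrightarrow> multiplicity p n = 0"
  proof -
    \<comment> \<open>The exponents 0 and 1 have the same truncated predecessor; \<open>a\<close>
      and \<open>b\<close> being at least 2 rules out the exponent 1.\<close>
    have "a * multiplicity p m = 0 \<or> a * multiplicity p m \<ge> 2"
         "b * multiplicity p n = 0 \<or> b * multiplicity p n \<ge> 2"
      using mult_le_mono[OF ab(1), of 1 "multiplicity p m"]
            mult_le_mono[OF ab(2), of 1 "multiplicity p n"]
      by (cases "multiplicity p m"; cases "multiplicity p n"; simp)+
    with E ab show ?thesis by auto
  qed
  hence "p dvd m \<longleftrightarrow> p dvd n"
    using pos p(1) by (metis prime_multiplicity_gt_zero_iff prime_imp_prime_elem neq0_conv)
  thus False using p nd ab by (auto simp: prime_dvd_mult_iff prime_dvd_power_iff)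
qed

text \<open>Powers of \<open>P\<close> serve as test fractions. No prime above \<open>P\<close>
  divides \<open>k\<close>, \<open>l\<close> or the fraction, so the tails at \<open>P\<close>
  cancel, and a representation has to solve one equation in the two valuations at
  \<open>P\<close>.\<close>

lemma local_equation:
  fixes k l a b m n P :: nat
  assumes repr: "totient_repr k l a b (of_nat (P ^ i) / of_nat (P ^ j)) m n"
  assumes pos: "k > 0" "l > 0" and ab: "a \<ge> 2" "b \<ge> 2" and P: "prime P"
  assumes large: "\<And>q. prime q \<Longrightarrow> q > P \<Longrightarrow> \<not> q dvd k * l"
  shows "(multiplicity P k + a * multiplicity P m - 1) + j =
         (multiplicity P l + b * multiplicity P n - 1) + i"
proof -
  let ?M = "k * m ^ a" and ?N = "l * n ^ b"
  have mn: "m > 0" "n > 0" using repr by (auto simp: totient_repr_def)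
  have P0: "P > 0" using P prime_gt_0_nat by blast
  have eq: "totient ?M * P ^ j = totient ?N * P ^ i"
    using totient_repr_cross[OF repr] pos P0 by simp
  have MN: "?M > 0" "?N > 0" using pos mn by simp_all
  have "\<not> q dvd k * l * P ^ i * P ^ j" if "prime q" "q > P" for q
    using large[OF that] that prime_dvd_prime_power_imp_eq[OF that(1) P]
    by (auto simp: prime_dvd_mult_iff)
  hence "q dvd ?M \<longleftrightarrow> q dvd ?N" if "prime q" "q > P" for q
    using totient_eq_imp_same_large_primes[OF pos mn _ _ ab eq _ that] P0 by simp
  hence tail: "totient_tail P ?M = totient_tail P ?N"
    using MN by (intro totient_tail_cong)
  have "multiplicity P (totient ?M * P ^ j) = multiplicity P (totient ?N * P ^ i)"
    using eq by simp
  hence "multiplicity P (totient ?M) + j = multiplicity P (totient ?N) + i"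
    using MN P P0 by (simp add: prime_elem_multiplicity_mult_distrib)
  thus ?thesis
    using tail P MN pos mn by (simp add: multiplicity_totient multiplicity_mult_power)
qed

lemma gcd_gt_1_imp_ge_2:
  fixes a b :: nat
  assumes "a > 0" "b > 0" "gcd a b > 1"
  shows "a \<ge> 2 \<and> b \<ge> 2"
  using dvd_imp_le[OF gcd_dvd1, of a b] dvd_imp_le[OF gcd_dvd2, of b a] assms by linarith

text \<open>Modulo \<open>gcd a b\<close> the equation says 1 = 0. It arises whenever one truncated
  predecessor too many is subtracted on one side.\<close>

lemma gcd_eq_1_of_consecutive:
  fixes a b x x' y :: nat
  assumes "a * x + 1 = a * x' + b * y"
  shows "gcd a b = 1"
proof -
  have "gcd a b dvd a * x' + b * y" by simp
  hence "gcd a b dvd a * x + 1" using assms by simp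
  hence "gcd a b dvd 1" by (subst (asm) dvd_add_right_iff) simp_all
  thus ?thesis by simp
qed

text \<open>Test with \<open>P\<close> and 1/\<open>P\<close> for a prime \<open>P\<close> not
  dividing \<open>k * l\<close>. To represent \<open>P\<close>, either \<open>n\<close> is divisible
  by \<open>P\<close>, which forces \<open>gcd a b\<close> to be 1, or \<open>a * x = 2\<close>. The
  fraction 1/\<open>P\<close> treats \<open>b\<close> in the same way.\<close>

lemma totient_surj_imp_squares:
  assumes pos: "k > 0" "l > 0" and ab: "a \<ge> 2" "b \<ge> 2" and g: "gcd a b > 1"
  assumes surj: "\<And>r::rat. r > 0 \<Longrightarrow> \<exists>m n. totient_repr k l a b r m n"
  shows "a = 2 \<and> b = 2"
proof -
  obtain P where P: "prime P" "P > k * l" using bigger_prime by blast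
  have P0: "P > 0" using P by simp
  have large: "\<not> q dvd k * l" if "prime q" "q \<ge> P" for q
    using that P pos by (auto dest!: dvd_imp_le)
  have v0: "multiplicity P k = 0" "multiplicity P l = 0"
    using large[OF P(1)] by (auto intro!: not_dvd_imp_multiplicity_0)
  have sol: "\<exists>x y. (a * x - 1) + j = (b * y - 1) + i" for i j
  proof -
    have "(of_nat (P ^ i) / of_nat (P ^ j) :: rat) > 0" using P0 by simp
    from surj[OF this] obtain m n where
      "totient_repr k l a b (of_nat (P ^ i) / of_nat (P ^ j)) m n" by blast
    from local_equation[OF this pos ab P(1) large] v0 show ?thesis by auto
  qed
  have aux: "c = 2" if c: "c \<ge> 2" "d \<ge> 2" "gcd c d > 1" and xy: "c * x - 1 = (d * y - 1) + 1"
    for c d x y :: nat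
  proof -
    have x: "x > 0" using xy by (intro Nat.gr0I) auto
    have cx: "c * x \<ge> c" using x by simp
    show ?thesis
    proof (cases "y = 0")
      case True
      hence "c * x = 2" using xy cx c by simp
      thus ?thesis using cx c by linarith
    next
      case False
      hence "d * y \<ge> d" by simp
      hence "d * y + 1 = d * 0 + c * x" using xy c(2) by linarith
      from gcd_eq_1_of_consecutive[OF this] show ?thesis using c by (simp add: gcd.commute)
    qed
  qed
  \<comment> \<open>The test fraction is \<open>P\<close>; the reciprocal follows with the roles of
    \<open>a\<close> and \<open>b\<close> exchanged.\<close>
  obtain x y where "(a * x - 1) + 0 = (b * y - 1) + 1" using sol by blast
  hence "a = 2" using aux[of a b x y] ab g by simp
  moreover obtain x y where "(a * x - 1) + 1 = (b * y - 1) + 0" using sol by blast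
  hence "b = 2" using aux[of b a y x] ab g by (simp add: gcd.commute)
  ultimately show ?thesis ..
qed

text \<open>At the largest prime \<open>P\<close> dividing \<open>k * l\<close>, at least one of the
  truncations is always genuine, so the exponent of \<open>P\<close> meets a parity obstruction that
  some power of \<open>P\<close> violates.\<close>

lemma totient_squares_surj_imp_trivial:
  assumes pos: "k > 0" "l > 0"
  assumes surj: "\<And>r::rat. r > 0 \<Longrightarrow> \<exists>m n. totient_repr k l 2 2 r m n"
  shows "k * l = 1"
proof (rule ccontr)
  assume "k * l \<noteq> 1"
  then obtain q where q: "prime q" "q dvd k * l" using prime_factor_nat by blast
  have kl: "k * l > 0" using pos by simp
  have ne: "prime_factors (k * l) \<noteq> {}" using q kl by (auto simp: prime_factors_dvd)
  define P where "P = Max (prime_factors (k * l))"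
  have "P \<in> prime_factors (k * l)" unfolding P_def by (rule Max_in) (use ne in auto)
  hence P: "prime P" "P dvd k * l" by (auto simp: prime_factors_dvd)
  have P0: "P > 0" using P prime_gt_0_nat by blast
  have large: "\<not> q dvd k * l" if "prime q" "q > P" for q
  proof
    assume "q dvd k * l"
    hence "q \<in> prime_factors (k * l)" using that kl by (auto simp: prime_factors_dvd)
    hence "q \<le> P" unfolding P_def by (intro Max_ge) auto
    thus False using that by simp
  qed
  define \<kappa> \<mu> where "\<kappa> = multiplicity P k" and "\<mu> = multiplicity P l"
  have "\<kappa> > 0 \<or> \<mu> > 0"
    using P pos prime_dvd_mult_iff[OF P(1)]
    by (auto simp: \<kappa>_def \<mu>_def prime_multiplicity_gt_zero_iff)
  have sol: "\<exists>x y. (\<kappa> + 2 * x - 1) + j = (\<mu> + 2 * y - 1) + i" for i j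
  proof -
    have "(of_nat (P ^ i) / of_nat (P ^ j) :: rat) > 0" using P0 by simp
    from surj[OF this] obtain m n where
      "totient_repr k l 2 2 (of_nat (P ^ i) / of_nat (P ^ j)) m n" by blast
    from local_equation[OF this pos _ _ P(1) large] show ?thesis by (auto simp: \<kappa>_def \<mu>_def)
  qed
  consider "\<kappa> > 0" "\<mu> > 0" | "\<kappa> > 0" "\<mu> = 0" | "\<kappa> = 0" "\<mu> > 0"
    using \<open>\<kappa> > 0 \<or> \<mu> > 0\<close> by blast
  thus False
  proof cases
    case 1
    \<comment> \<open>Both predecessors are genuine, so \<open>i - j\<close> is congruent to
      \<kappa> - \<mu> modulo 2; the test exponents violate this.\<close>
    obtain x y where "(\<kappa> + 2 * x - 1) + \<mu> = (\<mu> + 2 * y - 1) + (\<kappa> + 1)" using sol by blast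
    with 1 have "2 * x = 2 * y + 1" by simp
    thus False by presburger
  next
    case 2
    \<comment> \<open>The right-hand value is 0 or odd, the left-hand one must be even. The choice 3
      instead of 1 also makes it positive, which excludes the solution x = y = 0.\<close>
    obtain x y where "(\<kappa> + 2 * x - 1) + 3 = (\<mu> + 2 * y - 1) + \<kappa>" using sol by blast
    with 2 have "2 * x + 2 = 2 * y - 1" by simp
    thus False by presburger
  next
    case 3
    obtain x y where "(\<kappa> + 2 * x - 1) + \<mu> = (\<mu> + 2 * y - 1) + 3" using sol by blast
    with 3 have "2 * y + 2 = 2 * x - 1" by simp
    thus False by presburger
  qed
qed

section \<open>Uniqueness of proper representations\<close>

text \<open>
  The valuations at one prime \<open>p\<close> of an improper representation, with \<open>d\<^sub>1 = p\<^sup>s\<close> and \<open>d\<^sub>2 = p\<^sup>t\<close>.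
\<close>
definition reducible :: "nat \<Rightarrow> nat \<Rightarrow> nat \<Rightarrow> nat \<Rightarrow> nat \<Rightarrow> nat \<Rightarrow> bool" where
  "reducible \<kappa> \<mu> a b x y \<longleftrightarrow>
     (\<exists>s t. 0 < s \<and> s \<le> x \<and> t \<le> y \<and> a * s = b * t \<and> (\<kappa> + (x - s) > 0 \<longleftrightarrow> \<mu> + (y - t) > 0))"

text \<open>With \<open>d1 = p ^ s\<close> and \<open>d2 = p ^ t\<close> the condition on primes
  concerns \<open>p\<close> alone. The equivalence in \<open>reducible\<close> says that
  \<open>p\<close> divides both or neither of \<open>k * m1\<close> and \<open>l * n1\<close>, and
  these are its two alternatives.\<close>

lemma proper_imp_not_reducible:
  assumes repr: "proper_totient_repr k l a b r m n" and pos: "k > 0" "l > 0" and p: "prime p"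
  shows "\<not> reducible (multiplicity p k) (multiplicity p l) a b (multiplicity p m) (multiplicity p n)"
proof
  assume "reducible (multiplicity p k) (multiplicity p l) a b (multiplicity p m) (multiplicity p n)"
  then obtain s t where st: "0 < s" "s \<le> multiplicity p m" "t \<le> multiplicity p n" "a * s = b * t"
    "multiplicity p k + (multiplicity p m - s) > 0 \<longleftrightarrow> multiplicity p l + (multiplicity p n - t) > 0"
    unfolding reducible_def by (elim exE conjE) (rule that)
  have mn: "m > 0" "n > 0" using repr by (auto simp: proper_totient_repr_def totient_repr_def)
  obtain m1 where "m = p ^ s * m1"
    using multiplicity_dvd'[OF st(2)] by (elim dvdE)
  hence m1: "m = m1 * p ^ s" by (simp only: mult.commute)
  obtain n1 where "n = p ^ t * n1"
    using multiplicity_dvd'[OF st(3)] by (elim dvdE)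
  hence n1: "n = n1 * p ^ t" by (simp only: mult.commute)
  have p1: "p > 1" using p prime_gt_1_nat by blast
  have mn1: "m1 > 0" "n1 > 0" using mn m1 n1 by (auto intro!: Nat.gr0I)
  have vm: "multiplicity p m - s = multiplicity p m1" "multiplicity p n - t = multiplicity p n1"
    using m1 n1 mn1 p p1 by (simp_all add: prime_elem_multiplicity_mult_distrib)
  have "multiplicity p k + multiplicity p m1 > 0 \<longleftrightarrow> p dvd k * m1"
       "multiplicity p l + multiplicity p n1 > 0 \<longleftrightarrow> p dvd l * n1"
    using pos mn1 p by (auto simp: prime_multiplicity_gt_zero_iff prime_dvd_mult_iff)
  hence iff: "p dvd k * m1 \<longleftrightarrow> p dvd l * n1" using st(5) vm by simp
  have local: "q dvd gcd (k * m1) (l * n1) \<or> gcd q (k * l * m1 * n1) = 1"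
    if "prime q" "q dvd p ^ s * p ^ t" for q
  proof -
    have "q = p" using that prime_dvd_prime_power_imp_eq[OF that(1) p]
      by (auto simp: prime_dvd_mult_iff)
    moreover have "gcd p (k * l * m1 * n1) = 1" if "\<not> p dvd k * m1"
    proof -
      have "\<not> p dvd k * l * m1 * n1"
        using that iff p by (auto simp: prime_dvd_mult_iff)
      hence "coprime p (k * l * m1 * n1)" using p by (intro prime_imp_coprime)
      thus ?thesis by (simp only: coprime_iff_gcd_eq_1)
    qed
    ultimately show ?thesis using iff by auto
  qed
  have gt: "p ^ s > 1" "p ^ t > 0" using p1 st(1) one_less_power[of p s] by simp_all
  have pow: "(p ^ s) ^ a = (p ^ t) ^ b"
    unfolding power_mult [symmetric] using st(4) by (simp only: mult.commute)
  have irr: "\<not> (\<exists>d1 d2 m1 n1 :: nat. d1 > 1 \<and> d2 > 0 \<and> m1 > 0 \<and> n1 > 0 \<and>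
      m = m1 * d1 \<and> n = n1 * d2 \<and> d1 ^ a = d2 ^ b \<and>
      (\<forall>p. prime p \<and> p dvd d1 * d2 \<longrightarrow>
         p dvd gcd (k * m1) (l * n1) \<or> gcd p (k * l * m1 * n1) = 1))"
    using repr unfolding proper_totient_repr_def by (rule conjunct2)
  show False
  proof (rule notE[OF irr], intro exI conjI)
    show "\<forall>q. prime q \<and> q dvd p ^ s * p ^ t \<longrightarrow>
        q dvd gcd (k * m1) (l * n1) \<or> gcd q (k * l * m1 * n1) = 1"
      using local by blast
  qed (fact gt mn1 m1 n1 pow)+
qed

text \<open>The differences \<open>x - x'\<close> and \<open>y - y'\<close> are the witnesses:
  removing them from (x, y) leads to (x', y'), where \<open>p\<close> divides both sides or
  neither.\<close>

lemma reducible_if_less: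
  assumes "x' < x" "a > 0" "b > 0" "a * x + b * y' = a * x' + b * y" "\<kappa> + x' > 0 \<longleftrightarrow> \<mu> + y' > 0"
  shows "reducible \<kappa> \<mu> a b x y"
proof -
  have "a * x' < a * x" using assms by simp
  hence "b * y' < b * y" using assms(4) by linarith
  hence "y' < y" using assms by simp
  moreover have "a * (x - x') = b * (y - y')"
    using assms(4) \<open>a * x' < a * x\<close> by (simp add: diff_mult_distrib2)
  ultimately show ?thesis
    unfolding reducible_def using assms
    by (intro exI[of _ "x - x'"] exI[of _ "y - y'"]) auto
qed

text \<open>Let \<open>p\<close> divide both or neither side for (x, y), but exactly one for (x',
  y'). If both, one subtracted 1 is left over and the congruence modulo \<open>gcd a b\<close>
  fails. If neither, a predecessor of a number that is at least 2 would have to vanish.\<close>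

lemma local_support_determined:
  fixes \<kappa> \<mu> a b x y x' y' :: nat
  assumes ab: "a \<ge> 2" "b \<ge> 2" and g: "gcd a b > 1"
  assumes eq: "(\<kappa> + a * x - 1) + (\<mu> + b * y' - 1) = (\<kappa> + a * x' - 1) + (\<mu> + b * y - 1)"
  assumes S: "\<kappa> + x > 0 \<longleftrightarrow> \<mu> + y > 0"
  shows "\<kappa> + x' > 0 \<longleftrightarrow> \<mu> + y' > 0"
proof (rule ccontr)
  assume S': "\<not> ?thesis"
  have big: "z = 0 \<and> c * z = 0 \<or> z > 0 \<and> c * z \<ge> 2" if "c \<ge> 2" for c z :: nat
    using mult_le_mono[OF that, of 1 z] by (cases z) auto
  note bx = big[OF ab(1), of x] big[OF ab(1), of x'] big[OF ab(2), of y] big[OF ab(2), of y']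
  consider (L) "\<kappa> + x' > 0" "\<mu> = 0" "y' = 0" | (R) "\<kappa> = 0" "x' = 0" "\<mu> + y' > 0"
    using S' by auto
  thus False
  proof cases
    case L
    show ?thesis
    proof (cases "y > 0")
      case True
      hence "a * x + 1 = a * x' + b * y" using L eq S bx by auto
      from gcd_eq_1_of_consecutive[OF this] g show ?thesis by simp
    next
      case False
      thus ?thesis using L eq S bx by auto
    qed
  next
    case R
    show ?thesis
    proof (cases "x > 0")
      case True
      hence "b * y + 1 = b * y' + a * x" using R eq S bx by auto
      from gcd_eq_1_of_consecutive[OF this] g show ?thesis by (simp add: gcd.commute)
    next
      case False
      thus ?thesis using R eq S bx by auto
    qed
  qed
qed

text \<open>If \<open>p\<close> divides both or neither side in each solution, the differences of
  the solutions are proportional, and the larger solution would be reducible. Otherwise just one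
  side carries \<open>p\<close> in each, and its exponent can be read off.\<close>

lemma local_uniqueness:
  fixes \<kappa> \<mu> a b x y x' y' :: nat
  assumes ab: "a \<ge> 2" "b \<ge> 2" and g: "gcd a b > 1"
  assumes eq: "(\<kappa> + a * x - 1) + (\<mu> + b * y' - 1) = (\<kappa> + a * x' - 1) + (\<mu> + b * y - 1)"
  assumes irr: "\<not> reducible \<kappa> \<mu> a b x y" "\<not> reducible \<kappa> \<mu> a b x' y'"
  shows "x = x' \<and> y = y'"
proof -
  have SS': "(\<kappa> + x > 0 \<longleftrightarrow> \<mu> + y > 0) \<longleftrightarrow> (\<kappa> + x' > 0 \<longleftrightarrow> \<mu> + y' > 0)"
    using local_support_determined[OF ab g eq] local_support_determined[OF ab g eq[symmetric]] by blast
  show ?thesis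
  proof (cases "\<kappa> + x > 0 \<longleftrightarrow> \<mu> + y > 0")
    case True
    hence S': "\<kappa> + x' > 0 \<longleftrightarrow> \<mu> + y' > 0" using SS' by blast
    \<comment> \<open>Within each pair both truncations are genuine or both are void, so the
      subtracted ones cancel in the difference.\<close>
    have cancel: "A + B' = A' + B"
      if "A > 0 \<longleftrightarrow> B > 0" "A' > 0 \<longleftrightarrow> B' > 0" "(A - 1) + (B' - 1) = (A' - 1) + (B - 1)"
      for A B A' B' :: nat
      using that by linarith
    have "(\<kappa> + a * x) + (\<mu> + b * y') = (\<kappa> + a * x') + (\<mu> + b * y)"
      by (rule cancel[OF _ _ eq]) (use True S' ab in auto)
    hence E: "a * x + b * y' = a * x' + b * y" by simp
    have "\<not> x' < x" using reducible_if_less[OF _ _ _ E S'] ab irr by auto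
    moreover have "\<not> x < x'" using reducible_if_less[OF _ _ _ E[symmetric] True] ab irr by auto
    ultimately have "x = x'" by simp
    thus ?thesis using E ab by simp
  next
    case False
    hence S': "\<not> (\<kappa> + x' > 0 \<longleftrightarrow> \<mu> + y' > 0)" using SS' by blast
    have big: "c * z \<ge> 2" if "c \<ge> 2" "z > 0" for c z :: nat
      using mult_le_mono[of 2 c 1 z] that by simp
    have pos: "\<kappa> + a * x > 0 \<longleftrightarrow> \<kappa> + x > 0" "\<kappa> + a * x' > 0 \<longleftrightarrow> \<kappa> + x' > 0"
              "\<mu> + b * y > 0 \<longleftrightarrow> \<mu> + y > 0" "\<mu> + b * y' > 0 \<longleftrightarrow> \<mu> + y' > 0"
      using ab by auto
    \<comment> \<open>In \<open>m\<close> and \<open>n\<close> the same side carries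
      \<open>p\<close> in both solutions. In \<open>mn\<close> and \<open>nm\<close> the sides
      differ, which forces \<kappa> = \<mu> = 0 and makes a sum with a positive term vanish.\<close>
    consider (m) "\<kappa> + x > 0" "\<mu> = 0" "y = 0" "\<kappa> + x' > 0" "y' = 0"
      | (n) "\<mu> + y > 0" "\<kappa> = 0" "x = 0" "\<mu> + y' > 0" "x' = 0"
      | (mn) "\<kappa> = 0" "\<mu> = 0" "y = 0" "x' = 0" "x > 0"
      | (nm) "\<kappa> = 0" "\<mu> = 0" "x = 0" "y' = 0" "x' > 0"
      using False S' by atomize_elim presburger
    thus ?thesis
    proof cases
      case m
      hence "\<kappa> + a * x > 0" "\<kappa> + a * x' > 0" "\<kappa> + a * x - 1 = \<kappa> + a * x' - 1"
        using eq pos by simp_all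
      hence "\<kappa> + a * x = \<kappa> + a * x'" by linarith
      thus ?thesis using m ab by simp
    next
      case n
      hence "\<mu> + b * y > 0" "\<mu> + b * y' > 0" "\<mu> + b * y - 1 = \<mu> + b * y' - 1"
        using eq pos by simp_all
      hence "\<mu> + b * y = \<mu> + b * y'" by linarith
      thus ?thesis using n ab by simp
    next
      case mn
      hence "a * x \<le> 1" using eq by simp
      thus ?thesis using big[OF ab(1) mn(5)] by linarith
    next
      case nm
      hence "a * x' \<le> 1" using eq by simp
      thus ?thesis using big[OF ab(1) nm(5)] by linarith
    qed
  qed
qed

text \<open>Two distinct pairs differ in valuation at a largest prime. Above it they have the same
  prime divisors, so the tails cancel there and \<open>local_uniqueness\<close> gives a
  contradiction.\<close>

lemma proper_totient_repr_unique:
  assumes pos: "k > 0" "l > 0" "a > 0" "b > 0" and g: "gcd a b > 1"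
  assumes r1: "proper_totient_repr k l a b r m n" and r2: "proper_totient_repr k l a b r m' n'"
  shows "(m, n) = (m', n')"
proof (rule ccontr)
  assume neq: "(m, n) \<noteq> (m', n')"
  have ab: "a \<ge> 2" "b \<ge> 2"
    using gcd_gt_1_imp_ge_2[OF pos(3,4) g] by auto
  let ?M = "k * m ^ a" and ?N = "l * n ^ b" and ?M' = "k * m' ^ a" and ?N' = "l * n' ^ b"
  have mn: "m > 0" "n > 0" "m' > 0" "n' > 0"
    using r1 r2 by (auto simp: proper_totient_repr_def totient_repr_def)
  have MN: "?M > 0" "?N > 0" "?M' > 0" "?N' > 0" using pos mn by simp_all
  have "(of_nat (totient ?M) / of_nat (totient ?N) :: rat) = of_nat (totient ?M') / of_nat (totient ?N')"
    using r1 r2 by (simp add: proper_totient_repr_def totient_repr_def)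
  hence "(of_nat (totient ?M * totient ?N') :: rat) = of_nat (totient ?M' * totient ?N)"
    using MN by (simp add: frac_eq_eq)
  hence eq: "totient ?M * totient ?N' = totient ?M' * totient ?N"
    unfolding of_nat_eq_iff .
  define D where "D = {p. prime p \<and> \<not> (multiplicity p m = multiplicity p m' \<and>
                                           multiplicity p n = multiplicity p n')}"
  have "D \<subseteq> prime_factors (m * m' * n * n')"
  proof
    fix p assume p: "p \<in> D"
    have "p dvd m * m' * n * n'"
    proof (rule ccontr)
      assume "\<not> ?thesis"
      hence "\<not> p dvd m" "\<not> p dvd m'" "\<not> p dvd n" "\<not> p dvd n'" by auto
      thus False using p by (simp add: D_def not_dvd_imp_multiplicity_0)
    qed
    thus "p \<in> prime_factors (m * m' * n * n')"
      using p mn by (auto simp: D_def prime_factors_dvd)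
  qed
  hence fin: "finite D" by (rule finite_subset) auto
  have ne: "D \<noteq> {}"
  proof
    assume "D = {}"
    hence *: "multiplicity p m = multiplicity p m'" "multiplicity p n = multiplicity p n'"
      if "prime p" for p using that by (auto simp: D_def)
    have "m = m'" using mn *(1) by (intro multiplicity_eq_nat[of m m']) simp_all
    moreover have "n = n'" using mn *(2) by (intro multiplicity_eq_nat[of n n']) simp_all
    ultimately show False using neq by simp
  qed
  define p where "p = Max D"
  have pD: "p \<in> D" unfolding p_def by (rule Max_in[OF fin ne])
  hence p: "prime p" by (simp add: D_def)
  have agree: "multiplicity q m = multiplicity q m'" "multiplicity q n = multiplicity q n'"
    if "prime q" "q > p" for q
  proof -
    have "q \<notin> D" using that Max_ge[OF fin, of q] by (auto simp: p_def)
    thus "multiplicity q m = multiplicity q m'" "multiplicity q n = multiplicity q n'"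
      using that by (auto simp: D_def)
  qed
  have dvd_agree: "q dvd m \<longleftrightarrow> q dvd m'" "q dvd n \<longleftrightarrow> q dvd n'" if "prime q" "q > p" for q
    using agree[OF that] mn that(1)
    by (metis prime_multiplicity_gt_zero_iff prime_imp_prime_elem neq0_conv)+
  \<comment> \<open>The tails of the two numerators, and likewise of the two denominators, are
    compared; within one representation they may well differ.\<close>
  have t1: "totient_tail p ?M = totient_tail p ?M'"
    using MN dvd_agree pos by (intro totient_tail_cong) (auto simp: prime_dvd_mult_iff prime_dvd_power_iff)
  have t2: "totient_tail p ?N = totient_tail p ?N'"
    using MN dvd_agree pos by (intro totient_tail_cong) (auto simp: prime_dvd_mult_iff prime_dvd_power_iff)
  have "multiplicity p (totient ?M) + multiplicity p (totient ?N') =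
        multiplicity p (totient ?M') + multiplicity p (totient ?N)"
    using arg_cong[OF eq, of "multiplicity p"] MN p
    by (simp add: prime_elem_multiplicity_mult_distrib)
  hence "(multiplicity p k + a * multiplicity p m - 1) + (multiplicity p l + b * multiplicity p n' - 1) =
         (multiplicity p k + a * multiplicity p m' - 1) + (multiplicity p l + b * multiplicity p n - 1)"
    using t1 t2 p MN pos mn by (simp add: multiplicity_totient multiplicity_mult_power)
  from local_uniqueness[OF ab g this proper_imp_not_reducible[OF r1 pos(1,2) p]
      proper_imp_not_reducible[OF r2 pos(1,2) p]]
  show False using pD by (simp add: D_def)
qed

section \<open>The criterion and the uniqueness statement combined\<close>

theorem theorem1:
  fixes k l a b :: nat
  assumes "k > 0" and "l > 0" and "a > 0" and "b > 0" and "max a b \<ge> 2"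
  shows "((\<forall>r::rat. r > 0 \<longrightarrow> (\<exists>m n. totient_repr k l a b r m n)) \<longleftrightarrow>
            (gcd a b = 1 \<or> (a, b, k, l) = (2, 2, 1, 1))) \<and>
         (gcd a b > 1 \<longrightarrow>
            (\<forall>r::rat. r > 0 \<longrightarrow>
               (\<forall>m n m' n'. proper_totient_repr k l a b r m n \<longrightarrow>
                  proper_totient_repr k l a b r m' n' \<longrightarrow> (m, n) = (m', n'))))"
proof (intro conjI iffI)
  assume surj: "\<forall>r::rat. r > 0 \<longrightarrow> (\<exists>m n. totient_repr k l a b r m n)"
  show "gcd a b = 1 \<or> (a, b, k, l) = (2, 2, 1, 1)"
  proof (cases "gcd a b = 1")
    case False
    moreover have "gcd a b > 0" using assms by simp
    ultimately have g: "gcd a b > 1" by linarith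
    have ab: "a \<ge> 2" "b \<ge> 2"
      using gcd_gt_1_imp_ge_2[OF assms(3,4) g] by auto
    have "a = 2 \<and> b = 2"
      using totient_surj_imp_squares[OF assms(1,2) ab g] surj by blast
    moreover from this have "k * l = 1"
      using totient_squares_surj_imp_trivial[OF assms(1,2)] surj by blast
    ultimately show ?thesis by simp
  qed simp
next
  assume "gcd a b = 1 \<or> (a, b, k, l) = (2, 2, 1, 1)"
  thus "\<forall>r::rat. r > 0 \<longrightarrow> (\<exists>m n. totient_repr k l a b r m n)"
  proof (elim disjE)
    assume "gcd a b = 1"
    thus ?thesis by (intro allI impI ex_totient_repr_coprime assms(1-4))
  next
    assume "(a, b, k, l) = (2, 2, 1, 1)"
    hence "a = 2" "b = 2" "k = 1" "l = 1" by simp_all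
    thus ?thesis using ex_totient_repr_squares by (simp only:) blast
  qed
next
  show "gcd a b > 1 \<longrightarrow> (\<forall>r::rat. r > 0 \<longrightarrow>
               (\<forall>m n m' n'. proper_totient_repr k l a b r m n \<longrightarrow>
                  proper_totient_repr k l a b r m' n' \<longrightarrow> (m, n) = (m', n')))"
    by (intro impI allI) (rule proper_totient_repr_unique[OF assms(1-4)])
qed

end
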